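(* Let $k,n,s$ be positive integers and let $x_1,\dots,x_n$ be independent variables. Then \[ h_k(x_1^{s+1},\ldots,x_n^{s+1})=\sum_{j=0}^{k(s+1)} (-1)^{j} h_j(x_1,\ldots,x_n)\, M_{k(s+1)-j}^{(s)}(x_1,\ldots,x_n) \] and \[ e_k(x_1,\ldots,x_n)=\sum_{j=0}^{\lfloor k/(s+1) \rfloor} (-1)^{j} e_j(x_1^{s+1},\ldots,x_n^{s+1})\, M_{k-j(s+1)}^{(s)}(x_1,\ldots,x_n). \] Moreover, if $k\not\equiv 0 \pmod{s+1}$, then \[ \sum_{j=0}^k (-1)^j h_j(x_1,\ldots,x_n)\, M_{k-j}^{(s)}(x_1,\ldots,x_n) = 0. \]
   Context: $M_{m}^{(s)}(x_{1},\ldots,x_{n})=\sum x_{1}^{a_{1}}\cdots x_{n}^{a_{n}}$, the sum over all $n$-tuples of nonnegative integers with $a_1+\cdots+a_n=m$ and each $a_i\equiv 0$ or $1 \pmod{s+1}$. $h_j$ and $e_j$ denote the complete homogeneous and elementary symmetric polynomials of degree $j$ (with $h_0=e_0=1$, $e_j=0$ for $j>n$). *)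

theory Defs
  imports "HOL-Library.Poly_Mapping" "HOL-Library.FuncSet" "HOL-Number_Theory.Cong"
begin

text \<open>
  Polynomials in the independent variables \<open>X 0, X 1, X 2, \<dots>\<close> over a coefficient ring, as finitely
  supported maps from exponent vectors to coefficients; ring multiplication on this type is
  convolution.
\<close>

type_synonym 'a mpoly = "(nat \<Rightarrow>\<^sub>0 nat) \<Rightarrow>\<^sub>0 'a"

definition X :: "nat \<Rightarrow> 'a::comm_ring_1 mpoly" where
  "X i = Poly_Mapping.single (Poly_Mapping.single i 1) 1"

text \<open>
  An \<open>n\<close>-tuple of nonnegative integers is a function on \<open>{1..n}\<close>, extensional (i.e. \<open>undefined\<close>
  outside \<open>{1..n}\<close>) so that each tuple is represented exactly once.
\<close>

definition exponents :: "nat \<Rightarrow> nat \<Rightarrow> (nat \<Rightarrow> nat) set" where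
  "exponents n m = {a \<in> {1..n} \<rightarrow>\<^sub>E UNIV. (\<Sum>i = 1..n. a i) = m}"

lemma finite_exponents: "finite (exponents n m)"
proof (rule finite_subset)
  show "exponents n m \<subseteq> {1..n} \<rightarrow>\<^sub>E {..m}"
    unfolding exponents_def
    by (auto simp: PiE_iff extensional_def intro: member_le_sum)
qed (simp add: finite_PiE)

text \<open>
  The following symmetric polynomials are defined by their values at an arbitrary \<open>n\<close>-tuple
  \<open>x 1, \<dots>, x n\<close>, so that they can be applied both to the variables and to powers of them.
\<close>

definition hsym :: "nat \<Rightarrow> nat \<Rightarrow> (nat \<Rightarrow> 'b::comm_ring_1) \<Rightarrow> 'b" where
  "hsym n j x = (\<Sum>a \<in> exponents n j. \<Prod>i = 1..n. x i ^ a i)"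

definition esym :: "nat \<Rightarrow> nat \<Rightarrow> (nat \<Rightarrow> 'b::comm_ring_1) \<Rightarrow> 'b" where
  "esym n j x = (\<Sum>A | A \<subseteq> {1..n} \<and> card A = j. \<Prod>i \<in> A. x i)"

definition Msym :: "nat \<Rightarrow> nat \<Rightarrow> nat \<Rightarrow> (nat \<Rightarrow> 'b::comm_ring_1) \<Rightarrow> 'b" where
  "Msym s n m x =
     (\<Sum>a | a \<in> exponents n m \<and> (\<forall>i\<in>{1..n}. [a i = 0] (mod (s + 1)) \<or> [a i = 1] (mod (s + 1))).
        \<Prod>i = 1..n. x i ^ a i)"

end

theory Submission
  imports Defs "HOL-Computational_Algebra.Formal_Power_Series"
begin

unbundle fps_syntax

text \<open>
  Put \<open>q = s + 1\<close>. The series \<open>\<Sum>\<^sub>m M\<^sub>m t\<^sup>m\<close> is the product over \<open>i\<close> of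
  \<open>(1 + x\<^sub>i t) / (1 - (x\<^sub>i t)\<^sup>q)\<close>, because \<open>q \<ge> 2\<close> makes the residues 0 and 1 distinct.
  Multiplying it by \<open>\<Prod>\<^sub>i 1 / (1 + x\<^sub>i t)\<close>, the generating series of \<open>(-1)\<^sup>j h\<^sub>j\<close>, gives the first
  and third identities; multiplying it by \<open>\<Prod>\<^sub>i (1 - (x\<^sub>i t)\<^sup>q)\<close> gives the second.
\<close>

section \<open>Coefficients of products of power series\<close>

text \<open>Induction on \<open>n\<close>: the Cauchy product with the last factor splits a tuple
  into its last exponent \<open>l\<close> and the remaining \<open>n\<close> exponents.\<close>

lemma fps_prod_nth_exponents:
  fixes F :: "nat \<Rightarrow> 'b::comm_ring_1 fps"
  shows "(\<Prod>i = 1..n. F i) $ m = (\<Sum>a\<in>exponents n m. \<Prod>i = 1..n. F i $ a i)"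
proof (induction n arbitrary: m)
  case 0
  \<comment> \<open>By extensionality the empty tuple is exactly one function, and its sum is
    0.\<close>
  have "exponents 0 m = (if m = 0 then {\<lambda>_. undefined} else {})"
    by (auto simp: exponents_def)
  then show ?case by simp
next
  case (Suc n)
  have prod_upd: "(\<Prod>i = 1..n. F i $ (a(Suc n := l)) i) = (\<Prod>i = 1..n. F i $ a i)" for a l
    by (rule prod.cong) auto
  have sum_upd: "(\<Sum>i = 1..n. (a(Suc n := l)) i) = (\<Sum>i = 1..n. a i)" for a :: "nat \<Rightarrow> nat" and l
    by (rule sum.cong) auto
  have "(\<Prod>i = 1..Suc n. F i) $ m = (F (Suc n) * (\<Prod>i = 1..n. F i)) $ m"
    by (simp add: mult.commute)
  also have "\<dots> = (\<Sum>l = 0..m. \<Sum>a\<in>exponents n (m - l). F (Suc n) $ l * (\<Prod>i = 1..n. F i $ a i))"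
    by (simp only: fps_mult_nth Suc sum_distrib_left)
  also have "\<dots> = (\<Sum>(l, a)\<in>(SIGMA l:{0..m}. exponents n (m - l)).
                  F (Suc n) $ l * (\<Prod>i = 1..n. F i $ a i))"
    by (rule sum.Sigma) (auto simp: finite_exponents)
  also have "\<dots> = (\<Sum>a\<in>exponents (Suc n) m. \<Prod>i = 1..Suc n. F i $ a i)"
  \<comment> \<open>Removing the last entry resets it to \<open>undefined\<close>, since a member of
    \<open>exponents n\<close> must be extensional on \<open>{1..n}\<close>.\<close>
  proof (rule sum.reindex_bij_witness
      [where i = "\<lambda>a. (a (Suc n), a(Suc n := undefined))" and j = "\<lambda>(l, a). a(Suc n := l)"], goal_cases)
    case (1 p)
    then show ?case by (auto simp: exponents_def PiE_iff extensional_def)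
  next
    case (2 p)
    then show ?case
      by (auto simp: exponents_def PiE_iff extensional_def sum_upd simp del: fun_upd_apply)
        (auto)
  next
    case (3 a)
    then show ?case by auto
  next
    case (4 a)
    then show ?case
      by (auto simp: exponents_def PiE_iff extensional_def sum_upd simp del: fun_upd_apply)
        (auto)
  next
    case (5 p)
    then show ?case
      by (auto simp: prod_upd mult.commute simp del: fun_upd_apply) (auto)
  qed
  finally show ?case .
qed

section \<open>Geometric series and complete homogeneous polynomials\<close>

text \<open>For \<open>q > 0\<close> this is the expansion of \<open>1 / (1 - c t^q)\<close>, given
  by coefficients because the base ring need not have division.\<close>

definition geometric_fps :: "'b::comm_ring_1 \<Rightarrow> nat \<Rightarrow> 'b fps" where
  "geometric_fps c q = Abs_fps (\<lambda>m. if q dvd m then c ^ (m div q) else 0)"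

text \<open>Raising the index by \<open>q\<close> multiplies a coefficient by \<open>c\<close>, so
  all terms of index at least \<open>q\<close> cancel; below \<open>q\<close> only the constant term
  1 is nonzero.\<close>

lemma geometric_fps_mult:
  fixes c :: "'b::comm_ring_1"
  assumes "q > 0"
  shows "geometric_fps c q * (1 - fps_const c * fps_X ^ q) = 1"
proof (rule fps_ext)
  fix m
  have "(geometric_fps c q * (1 - fps_const c * fps_X ^ q)) $ m =
        geometric_fps c q $ m - c * (geometric_fps c q * fps_X ^ q) $ m"
    by (simp add: right_diff_distrib mult.left_commute[of _ "fps_const c"])
  also have "\<dots> = (1 :: 'b fps) $ m"
  proof (cases "m < q")
    case True
    then show ?thesis
      by (auto simp: geometric_fps_def fps_X_power_mult_right_nth)
  next
    case False
    then obtain l where "m = l + q"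
      by (metis le_add_diff_inverse2 not_less)
    then show ?thesis
      using assms by (auto simp: geometric_fps_def fps_X_power_mult_right_nth)
  qed
  finally show "(geometric_fps c q * (1 - fps_const c * fps_X ^ q)) $ m = (1 :: 'b fps) $ m" .
qed

text \<open>Only tuples with all entries divisible by \<open>q\<close> contribute, and dividing the
  entries by \<open>q\<close> matches these with the tuples of sum \<open>k\<close>.\<close>

lemma prod_geometric_fps_nth:
  fixes y :: "nat \<Rightarrow> 'b::comm_ring_1"
  assumes "q > 0"
  shows "(\<Prod>i = 1..n. geometric_fps (y i) q) $ (q * k) = hsym n k y"
proof -
  let ?f = "\<lambda>a. \<Prod>i = 1..n. geometric_fps (y i) q $ a i"
  let ?D = "{a \<in> exponents n (q * k). \<forall>i\<in>{1..n}. q dvd a i}"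
  have "(\<Prod>i = 1..n. geometric_fps (y i) q) $ (q * k) = (\<Sum>a\<in>exponents n (q * k). ?f a)"
    by (rule fps_prod_nth_exponents)
  also have "\<dots> = (\<Sum>a\<in>?D. ?f a)"
    by (rule sum.mono_neutral_right)
      (auto simp: finite_exponents geometric_fps_def intro!: prod_zero)
  also have "\<dots> = (\<Sum>a\<in>exponents n k. \<Prod>i = 1..n. y i ^ a i)"
  proof (rule sum.reindex_bij_witness
      [where i = "\<lambda>a. restrict (\<lambda>i. q * a i) {1..n}" and j = "\<lambda>a. restrict (\<lambda>i. a i div q) {1..n}"],
      goal_cases)
    case (1 a)
    then show ?case by (auto simp: exponents_def PiE_iff extensional_def fun_eq_iff)
  next
    case (2 a)
    then have "q * (\<Sum>i = 1..n. a i div q) = q * k"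
      by (simp add: exponents_def sum_distrib_left)
    with assms 2 show ?case by (auto simp: exponents_def)
  next
    case (3 a)
    with assms show ?case by (auto simp: exponents_def PiE_iff extensional_def fun_eq_iff)
  next
    case (4 a)
    then show ?case by (auto simp: exponents_def simp flip: sum_distrib_left)
  next
    case (5 a)
    then show ?case by (auto simp: geometric_fps_def intro!: prod.cong)
  qed
  finally show ?thesis by (simp add: hsym_def)
qed

text \<open>If \<open>q\<close> divided every entry of a tuple it would divide the sum
  \<open>m\<close>; so some entry is not a multiple of \<open>q\<close>, and its factor
  vanishes.\<close>

lemma prod_geometric_fps_nth_eq_0:
  fixes y :: "nat \<Rightarrow> 'b::comm_ring_1"
  assumes "\<not> q dvd m"
  shows "(\<Prod>i = 1..n. geometric_fps (y i) q) $ m = 0"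
proof -
  have "(\<Prod>i = 1..n. geometric_fps (y i) q $ a i) = 0" if a: "a \<in> exponents n m" for a
  proof -
    have "\<exists>i\<in>{1..n}. \<not> q dvd a i"
      using assms a by (auto simp: exponents_def intro: dvd_sum)
    then show ?thesis by (auto simp: geometric_fps_def intro!: prod_zero)
  qed
  then show ?thesis by (simp only: fps_prod_nth_exponents sum.neutral_const cong: sum.cong)
qed

section \<open>Binomial products and elementary symmetric polynomials\<close>

text \<open>Expanding the product, the set \<open>A\<close> of factors that supply their second
  summand yields one monomial of degree \<open>q * card A\<close>. Keeping \<open>q\<close> general
  covers both the numerators (\<open>q = 1\<close>) and the denominators (\<open>q = s + 1\<close>)
  of the series for \<open>Msym\<close>.\<close>

lemma prod_binomial_fps_nth_eq_sum:
  fixes y :: "nat \<Rightarrow> 'b::comm_ring_1"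
  shows "(\<Prod>i = 1..n. 1 + fps_const (y i) * fps_X ^ q) $ m =
         (\<Sum>A | A \<subseteq> {1..n} \<and> q * card A = m. \<Prod>i\<in>A. y i)"
proof -
  have const: "(\<Prod>i\<in>A. fps_const (y i)) = fps_const (\<Prod>i\<in>A. y i)" for A
    by (induction A rule: infinite_finite_induct) auto
  have "(\<Prod>i = 1..n. 1 + fps_const (y i) * fps_X ^ q) =
        (\<Sum>A\<in>Pow {1..n}. fps_const (\<Prod>i\<in>A. y i) * fps_X ^ (q * card A))"
    using prod_add[of "{1..n}" "\<lambda>i. fps_const (y i) * fps_X ^ q" "\<lambda>_. 1"]
    by (simp add: prod.distrib const power_mult add.commute)
  then have "(\<Prod>i = 1..n. 1 + fps_const (y i) * fps_X ^ q) $ m =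
        (\<Sum>A\<in>Pow {1..n}. if q * card A = m then \<Prod>i\<in>A. y i else 0)"
    by (auto simp: fps_sum_nth intro!: sum.cong)
  also have "\<dots> = (\<Sum>A | A \<subseteq> {1..n} \<and> q * card A = m. \<Prod>i\<in>A. y i)"
    by (simp add: sum.If_cases Int_def)
  finally show ?thesis .
qed

lemma prod_binomial_fps_nth:
  fixes y :: "nat \<Rightarrow> 'b::comm_ring_1"
  assumes "q > 0"
  shows "(\<Prod>i = 1..n. 1 + fps_const (y i) * fps_X ^ q) $ (q * k) = esym n k y"
  unfolding prod_binomial_fps_nth_eq_sum esym_def using assms by simp

lemma prod_binomial_fps_nth_eq_0:
  fixes y :: "nat \<Rightarrow> 'b::comm_ring_1"
  assumes "\<not> q dvd m"
  shows "(\<Prod>i = 1..n. 1 + fps_const (y i) * fps_X ^ q) $ m = 0"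
proof -
  from assms have "{A. A \<subseteq> {1..n} \<and> q * card A = m} = {}" by auto
  then show ?thesis by (simp only: prod_binomial_fps_nth_eq_sum sum.empty)
qed

section \<open>Negation of the variables\<close>

text \<open>Homogeneity of degree \<open>k\<close>; this is where the signs in the first and third
  identities come from.\<close>

lemma hsym_uminus: "hsym n k (\<lambda>i. - y i) = (-1) ^ k * hsym n k y"
proof -
  have "(\<Prod>i = 1..n. (- y i) ^ a i) = (-1) ^ k * (\<Prod>i = 1..n. y i ^ a i)"
    if a: "a \<in> exponents n k" for a
  proof -
    have "(\<Prod>i = 1..n. (- y i) ^ a i) = (\<Prod>i = 1..n. (-1) ^ a i) * (\<Prod>i = 1..n. y i ^ a i)"
      by (simp add: prod.distrib[symmetric] power_mult_distrib[symmetric])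
    with a show ?thesis by (simp add: exponents_def flip: power_sum)
  qed
  then show ?thesis by (simp add: hsym_def sum_distrib_left)
qed

lemma esym_uminus: "esym n k (\<lambda>i. - y i) = (-1) ^ k * esym n k y"
  by (auto simp: esym_def prod_uminus sum_distrib_left intro!: sum.cong)

section \<open>The generating series of \<open>Msym\<close>\<close>

definition Mfactor :: "nat \<Rightarrow> 'b::comm_ring_1 \<Rightarrow> 'b fps" where
  "Mfactor s c = Abs_fps (\<lambda>m. if [m = 0] (mod (s + 1)) \<or> [m = 1] (mod (s + 1)) then c ^ m else 0)"

lemma prod_Mfactor_nth: "(\<Prod>i = 1..n. Mfactor s (x i)) $ m = Msym s n m x"
proof -
  let ?P = "\<lambda>a :: nat \<Rightarrow> nat. \<forall>i\<in>{1..n}. [a i = 0] (mod (s + 1)) \<or> [a i = 1] (mod (s + 1))"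
  have "(\<Prod>i = 1..n. Mfactor s (x i)) $ m =
        (\<Sum>a\<in>exponents n m. \<Prod>i = 1..n. Mfactor s (x i) $ a i)"
    by (rule fps_prod_nth_exponents)
  also have "\<dots> = (\<Sum>a | a \<in> exponents n m \<and> ?P a. \<Prod>i = 1..n. Mfactor s (x i) $ a i)"
    by (rule sum.mono_neutral_right)
      (auto simp: finite_exponents Mfactor_def intro!: prod_zero)
  also have "\<dots> = Msym s n m x"
    unfolding Msym_def by (intro sum.cong prod.cong) (auto simp: Mfactor_def)
  finally show ?thesis .
qed

text \<open>Indices that differ by \<open>s + 1\<close> satisfy the same congruences, so the product
  cancels from index \<open>s + 1\<close> on. Below that only the indices 0 and 1 survive, and they
  are distinct residues because \<open>s > 0\<close>.\<close>

lemma Mfactor_mult: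
  fixes c :: "'b::comm_ring_1"
  assumes "s > 0"
  shows "Mfactor s c * (1 - fps_const (c ^ (s + 1)) * fps_X ^ (s + 1)) = 1 + fps_const c * fps_X"
proof (rule fps_ext)
  fix m
  define q where "q = s + 1"
  have "q > 1" using assms by (simp add: q_def)
  have nth: "Mfactor s c $ l = (if l mod q = 0 \<or> l mod q = 1 then c ^ l else 0)" for l
    using \<open>q > 1\<close> by (simp add: Mfactor_def cong_def q_def)
  have "(Mfactor s c * (1 - fps_const (c ^ q) * fps_X ^ q)) $ m =
        Mfactor s c $ m - c ^ q * (Mfactor s c * fps_X ^ q) $ m"
    by (simp add: right_diff_distrib mult.left_commute[of _ "fps_const (c ^ q)"])
  also have "\<dots> = (1 + fps_const c * fps_X) $ m"
  proof (cases "m < q")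
    case True
    then show ?thesis
      by (auto simp: nth fps_X_power_mult_right_nth)
  next
    case False
    then obtain l where "m = l + q"
      by (metis le_add_diff_inverse2 not_less)
    then show ?thesis
      using \<open>q > 1\<close> by (simp add: nth fps_X_power_mult_right_nth power_add)
  qed
  finally show "(Mfactor s c * (1 - fps_const (c ^ (s + 1)) * fps_X ^ (s + 1))) $ m =
        (1 + fps_const c * fps_X) $ m" by (simp only: q_def)
qed

lemma one_plus_fps_const_uminus:
  "1 + fps_const (- d) * F = 1 - fps_const (d :: 'b::comm_ring_1) * F"
  by (simp only: fps_const_neg[symmetric] mult_minus_left diff_conv_add_uminus)

text \<open>Clears the denominators. The sign sits inside \<open>fps_const\<close> so that
  \<open>prod_binomial_fps_nth\<close> applies to the values
  \<open>- (x i ^ (s + 1))\<close>.\<close>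

lemma prod_Mfactor_mult:
  fixes x :: "nat \<Rightarrow> 'b::comm_ring_1"
  assumes "s > 0"
  shows "(\<Prod>i\<in>A. 1 + fps_const (- (x i ^ (s + 1))) * fps_X ^ (s + 1)) * (\<Prod>i\<in>A. Mfactor s (x i)) =
         (\<Prod>i\<in>A. 1 + fps_const (x i) * fps_X)"
  unfolding prod.distrib[symmetric]
proof (rule prod.cong)
  fix i
  show "(1 + fps_const (- (x i ^ (s + 1))) * fps_X ^ (s + 1)) * Mfactor s (x i) =
        1 + fps_const (x i) * fps_X"
    unfolding one_plus_fps_const_uminus
    by (subst mult.commute) (rule Mfactor_mult[OF assms])
qed simp

text \<open>In each factor \<open>1 / (1 + x i t)\<close> cancels the numerator of
  \<open>Mfactor s (x i)\<close>, leaving only the geometric series.\<close>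

lemma prod_geometric_fps_mult_Mfactor:
  fixes x :: "nat \<Rightarrow> 'b::comm_ring_1"
  assumes "s > 0"
  shows "(\<Prod>i\<in>A. geometric_fps (- x i) 1) * (\<Prod>i\<in>A. Mfactor s (x i)) =
         (\<Prod>i\<in>A. geometric_fps (x i ^ (s + 1)) (s + 1))"
  unfolding prod.distrib[symmetric]
proof (rule prod.cong)
  fix i
  let ?c = "x i"
  let ?H = "geometric_fps (- ?c) 1" and ?K = "geometric_fps (?c ^ (s + 1)) (s + 1)"
  let ?P = "1 - fps_const (?c ^ (s + 1)) * fps_X ^ (s + 1)"
  have "?K * ?P = 1"
    by (rule geometric_fps_mult) simp
  \<comment> \<open>Inserting \<open>?K * ?P = 1\<close> replaces division: \<open>?P\<close>
    reduces \<open>Mfactor\<close> to its numerator, which \<open>?H\<close> inverts.\<close>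
  then have "?H * Mfactor s ?c = ?H * Mfactor s ?c * (?K * ?P)"
    by (simp only: mult_1_right)
  also have "\<dots> = ?H * (Mfactor s ?c * ?P) * ?K"
    by (simp only: mult_ac)
  also have "\<dots> = (?H * (1 + fps_const ?c * fps_X)) * ?K"
    using assms by (simp only: Mfactor_mult)
  also have "?H * (1 + fps_const ?c * fps_X) = 1"
    using geometric_fps_mult[of 1 "- ?c"] by (simp del: fps_const_neg flip: one_plus_fps_const_uminus)
  finally show "?H * Mfactor s ?c = ?K" by simp
qed simp

section \<open>Comparison of coefficients\<close>

text \<open>Serves the first and third identities at once: they differ only in whether
  \<open>s + 1\<close> divides the index \<open>m\<close>.\<close>

lemma sum_hsym_Msym:
  fixes x :: "nat \<Rightarrow> 'b::comm_ring_1"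
  assumes "s > 0"
  shows "(\<Sum>j = 0..m. (-1) ^ j * hsym n j x * Msym s n (m - j) x) =
         (\<Prod>i = 1..n. geometric_fps (x i ^ (s + 1)) (s + 1)) $ m"
proof -
  have "(\<Prod>i = 1..n. geometric_fps (- x i) 1) $ j = (-1) ^ j * hsym n j x" for j
    using prod_geometric_fps_nth[of 1 "\<lambda>i. - x i" n j] by (simp add: hsym_uminus)
  then show ?thesis
    by (simp only: prod_geometric_fps_mult_Mfactor[OF assms, symmetric] fps_mult_nth prod_Mfactor_nth)
qed

text \<open>Compares coefficients of \<open>t^k\<close> in \<open>prod_Mfactor_mult\<close>.\<close>

lemma esym_eq_sum_Msym:
  fixes x :: "nat \<Rightarrow> 'b::comm_ring_1"
  assumes "s > 0"
  shows "esym n k x =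
         (\<Sum>j = 0..k div (s + 1).
            (-1) ^ j * esym n j (\<lambda>i. x i ^ (s + 1)) * Msym s n (k - j * (s + 1)) x)"
proof -
  define P where "P = (\<Prod>i = 1..n. 1 + fps_const (- (x i ^ (s + 1))) * fps_X ^ (s + 1))"
  have P_nth: "P $ (j * (s + 1)) = (-1) ^ j * esym n j (\<lambda>i. x i ^ (s + 1))" for j
    unfolding P_def esym_uminus[symmetric] mult.commute[of j] by (rule prod_binomial_fps_nth) simp
  have P_nth_eq_0: "P $ m = 0" if "\<not> (s + 1) dvd m" for m
    unfolding P_def using that by (rule prod_binomial_fps_nth_eq_0)
  have "esym n k x = (\<Prod>i = 1..n. 1 + fps_const (x i) * fps_X) $ k"
    using prod_binomial_fps_nth[of 1 x n k] by simp
  also have "\<dots> = (P * (\<Prod>i = 1..n. Mfactor s (x i))) $ k"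
    unfolding P_def prod_Mfactor_mult[OF assms] ..
  also have "\<dots> = (\<Sum>m = 0..k. P $ m * Msym s n (k - m) x)"
    by (simp only: fps_mult_nth prod_Mfactor_nth)
  \<comment> \<open>\<open>P\<close> is a polynomial in \<open>t^(s + 1)\<close>, so only multiples
    of \<open>s + 1\<close> up to \<open>k\<close> contribute.\<close>
  also have "\<dots> = (\<Sum>m\<in>(\<lambda>j. (s + 1) * j) ` {0..k div (s + 1)}. P $ m * Msym s n (k - m) x)"
  proof (rule sum.mono_neutral_right)
    show "(\<lambda>j. (s + 1) * j) ` {0..k div (s + 1)} \<subseteq> {0..k}"
      using less_eq_div_iff_mult_less_eq[of "s + 1" _ k] by (auto simp: mult.commute)
    show "\<forall>m\<in>{0..k} - (\<lambda>j. (s + 1) * j) ` {0..k div (s + 1)}. P $ m * Msym s n (k - m) x = 0"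
    proof
      fix m assume m: "m \<in> {0..k} - (\<lambda>j. (s + 1) * j) ` {0..k div (s + 1)}"
      have "\<not> (s + 1) dvd m"
      proof
        assume "(s + 1) dvd m"
        then have "m = (s + 1) * (m div (s + 1))" by (simp only: dvd_mult_div_cancel)
        moreover have "m div (s + 1) \<in> {0..k div (s + 1)}" using m by (auto intro: div_le_mono)
        ultimately show False using m by blast
      qed
      then show "P $ m * Msym s n (k - m) x = 0" by (simp add: P_nth_eq_0)
    qed
  qed simp
  also have "\<dots> = (\<Sum>j = 0..k div (s + 1). P $ ((s + 1) * j) * Msym s n (k - (s + 1) * j) x)"
    by (subst sum.reindex) (auto simp: inj_on_def simp del: mult_Suc)
  finally show ?thesis
    by (simp only: P_nth mult.commute[of "s + 1"])
qed

text \<open>The preceding lemmas hold for arbitrary values in any commutative ring; here they are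
  specialized to the variables \<open>X i\<close>.\<close>

theorem theorem5p3:
  fixes k n s :: nat
  assumes "k > 0" and "n > 0" and "s > 0"
  shows "hsym n k (\<lambda>i. (X i :: 'a::comm_ring_1 mpoly) ^ (s + 1)) =
           (\<Sum>j = 0..k * (s + 1). (-1) ^ j * hsym n j X * Msym s n (k * (s + 1) - j) X) \<and>
         esym n k (X :: nat \<Rightarrow> 'a mpoly) =
           (\<Sum>j = 0..k div (s + 1).
              (-1) ^ j * esym n j (\<lambda>i. X i ^ (s + 1)) * Msym s n (k - j * (s + 1)) X) \<and>
         (\<not> [k = 0] (mod (s + 1)) \<longrightarrow>
           (\<Sum>j = 0..k. (-1) ^ j * hsym n j (X :: nat \<Rightarrow> 'a mpoly) * Msym s n (k - j) X) = 0)"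
proof (intro conjI impI)
  show "hsym n k (\<lambda>i. (X i :: 'a mpoly) ^ (s + 1)) =
      (\<Sum>j = 0..k * (s + 1). (-1) ^ j * hsym n j X * Msym s n (k * (s + 1) - j) X)"
    unfolding sum_hsym_Msym[OF assms(3)] mult.commute[of k]
    by (rule prod_geometric_fps_nth[symmetric]) simp
next
  show "esym n k (X :: nat \<Rightarrow> 'a mpoly) =
      (\<Sum>j = 0..k div (s + 1).
         (-1) ^ j * esym n j (\<lambda>i. X i ^ (s + 1)) * Msym s n (k - j * (s + 1)) X)"
    by (rule esym_eq_sum_Msym[OF assms(3)])
next
  assume "\<not> [k = 0] (mod (s + 1))"
  then show "(\<Sum>j = 0..k. (-1) ^ j * hsym n j (X :: nat \<Rightarrow> 'a mpoly) * Msym s n (k - j) X) = 0"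
    unfolding sum_hsym_Msym[OF assms(3)] cong_0_iff by (rule prod_geometric_fps_nth_eq_0)
qed

end
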